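(* Let $\vec v\in\mathbb R^3$ be a unit vector. Let $\Sigma$ be a compact translating soliton (with density vector $\vec v$) whose boundary $\Gamma$ is contained in a plane $\Pi$. Then we have two possibilities: (1) $\Pi$ is parallel to $\vec v$ and the surface $\Sigma$ is included in $\Pi$. (2) $\Pi$ is not parallel to $\vec v$, the interior $\mathrm{int}(\Sigma)$ of $\Sigma$ lies in one side of $\Pi$ (i.e. in one of the two open halfspaces determined by $\Pi$), and $\Sigma$ is not tangent to $\Pi$ at any boundary point.
   Context: All surfaces are smooth, connected and oriented, and are immersed in Euclidean space $\mathbb R^3$. The mean curvature $H$ is the average of the two principal curvatures with respect to the Gauss map $N$, with sign convention $\Delta\psi=2HN$ for an immersion $\psi$. A translating soliton with density vector $\vec v$ is such a surface with $H=\langle N,\vec v\rangle/2$ everywhere on it. A closed curve $\Gamma\subset\mathbb R^3$ is the boundary of an immersed surface $\psi:\Sigma\to\mathbb R^3$ (with smooth boundary $\partial\Sigma$) if $\psi$ restricted to $\partial\Sigma$ is a diffeomorphism onto $\Gamma$. *)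

theory Defs
  imports "HOL-Analysis.Analysis"
begin

section \<open>Smooth maps between subsets of Euclidean spaces\<close>

text \<open>Only meant for open \<open>W\<close>: continuous (total) derivatives up to order \<open>k\<close>.\<close>

primrec Ck_on ::
  "nat \<Rightarrow> 'a::euclidean_space set \<Rightarrow> ('a \<Rightarrow> 'b::euclidean_space) \<Rightarrow> bool" where
  "Ck_on 0 W f \<longleftrightarrow> continuous_on W f"
| "Ck_on (Suc k) W f \<longleftrightarrow>
     (\<forall>x\<in>W. f differentiable (at x)) \<and>
     (\<forall>w. Ck_on k W (\<lambda>x. frechet_derivative f (at x) w))"

text \<open>On an arbitrary set \<open>S\<close>, smooth means: near each point of \<open>S\<close>, the restriction to \<open>S\<close> of
  a smooth map defined on an open set. This is the usual notion for relatively open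
  subsets of a half-plane, for plane curves and for space curves.\<close>

definition smooth_on :: "'a::euclidean_space set \<Rightarrow> ('a \<Rightarrow> 'b::euclidean_space) \<Rightarrow> bool" where
  "smooth_on S f \<longleftrightarrow>
     (\<forall>x\<in>S. \<exists>W g. open W \<and> x \<in> W \<and> (\<forall>k. Ck_on k W g) \<and> (\<forall>y\<in>S \<inter> W. g y = f y))"

text \<open>A closed curve: a subset of space diffeomorphic to the circle.\<close>

definition closed_curve :: "(real^3) set \<Rightarrow> bool" where
  "closed_curve \<Gamma> \<longleftrightarrow>
     (\<exists>f g. homeomorphism (sphere (0::real^2) 1) \<Gamma> f g \<and>
            smooth_on (sphere (0::real^2) 1) f \<and> smooth_on \<Gamma> g)"


section \<open>Oriented smooth surfaces with boundary\<close>

definition halfplane :: "(real^2) set" where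
  "halfplane = {u. 0 \<le> u $ 2}"

text \<open>A chart is a pair \<open>(U, \<phi>)\<close> of an open domain and a coordinate map; only the values
  of \<open>\<phi>\<close> on \<open>U\<close> matter.\<close>

type_synonym 'a chart = "'a set \<times> ('a \<Rightarrow> real^2)"

definition is_chart :: "'a topology \<Rightarrow> 'a chart \<Rightarrow> bool" where
  "is_chart M = (\<lambda>(U, \<phi>).
     openin M U \<and> openin (top_of_set halfplane) (\<phi> ` U) \<and>
     homeomorphic_map (subtopology M U) (top_of_set (\<phi> ` U)) \<phi>)"

text \<open>The differential at \<open>u\<close> of a map defined on a set \<open>S\<close> that is relatively open in the
  half-plane. It is uniquely determined, also at points of the boundary line.\<close>

abbreviation diff_on ::
  "(real^2) set \<Rightarrow> (real^2 \<Rightarrow> 'b::euclidean_space) \<Rightarrow> real^2 \<Rightarrow> real^2 \<Rightarrow> 'b" where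
  "diff_on S f u \<equiv> frechet_derivative f (at u within S)"

definition oriented_compatible :: "'a chart \<Rightarrow> 'a chart \<Rightarrow> bool" where
  "oriented_compatible = (\<lambda>(U, \<phi>) (V, \<phi>').
     let S = \<phi> ` (U \<inter> V); \<tau> = \<phi>' \<circ> inv_into U \<phi> in
     smooth_on S \<tau> \<and> (\<forall>u\<in>S. 0 < det (matrix (diff_on S \<tau> u))))"

definition oriented_surface :: "'a topology \<Rightarrow> 'a chart set \<Rightarrow> bool" where
  "oriented_surface M A \<longleftrightarrow>
     Hausdorff_space M \<and> second_countable M \<and> connected_space M \<and>
     (\<forall>c\<in>A. is_chart M c) \<and> (\<Union>c\<in>A. fst c) = topspace M \<and>
     (\<forall>c\<in>A. \<forall>d\<in>A. oriented_compatible c d)"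

definition surface_boundary :: "'a chart set \<Rightarrow> 'a set" where
  "surface_boundary A = {p. \<exists>(U, \<phi>)\<in>A. p \<in> U \<and> \<phi> p $ 2 = 0}"

definition surface_interior :: "'a topology \<Rightarrow> 'a chart set \<Rightarrow> 'a set" where
  "surface_interior M A = topspace M - surface_boundary A"


section \<open>Immersions into Euclidean space\<close>

text \<open>The local parametrization of a map \<open>\<psi>\<close> given by a chart, defined on \<open>\<phi> ` U\<close>.\<close>

definition local_param :: "('a \<Rightarrow> real^3) \<Rightarrow> 'a chart \<Rightarrow> real^2 \<Rightarrow> real^3" where
  "local_param \<psi> = (\<lambda>(U, \<phi>). \<psi> \<circ> inv_into U \<phi>)"

definition chart_image :: "'a chart \<Rightarrow> (real^2) set" where
  "chart_image = (\<lambda>(U, \<phi>). \<phi> ` U)"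

definition immersion :: "'a chart set \<Rightarrow> ('a \<Rightarrow> real^3) \<Rightarrow> bool" where
  "immersion A \<psi> \<longleftrightarrow>
     (\<forall>c\<in>A. smooth_on (chart_image c) (local_param \<psi> c) \<and>
        (\<forall>u\<in>chart_image c. inj (diff_on (chart_image c) (local_param \<psi> c) u)))"

text \<open>The image in space of the tangent plane of the surface at \<open>p\<close>. All charts at \<open>p\<close> give
  the same plane.\<close>

definition tangent_plane :: "'a chart set \<Rightarrow> ('a \<Rightarrow> real^3) \<Rightarrow> 'a \<Rightarrow> (real^3) set" where
  "tangent_plane A \<psi> p =
     (\<Union>c\<in>{c\<in>A. p \<in> fst c}. range (diff_on (chart_image c) (local_param \<psi> c) (snd c p)))"

text \<open>\<open>\<psi>\<close> restricted to the boundary is a diffeomorphism onto \<open>\<Gamma>\<close>. Smoothness of the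
  restriction and of its inverse is expressed in the charts of the surface.\<close>

definition has_boundary_curve ::
  "'a topology \<Rightarrow> 'a chart set \<Rightarrow> ('a \<Rightarrow> real^3) \<Rightarrow> (real^3) set \<Rightarrow> bool" where
  "has_boundary_curve M A \<psi> \<Gamma> \<longleftrightarrow>
     (let B = surface_boundary A in
       homeomorphic_map (subtopology M B) (top_of_set \<Gamma>) \<psi> \<and>
       (\<forall>(U, \<phi>)\<in>A. smooth_on (\<phi> ` (U \<inter> B)) (\<psi> \<circ> inv_into U \<phi>) \<and>
                  smooth_on (\<psi> ` (U \<inter> B)) (\<phi> \<circ> inv_into B \<psi>)))"


section \<open>Gauss map, mean curvature and translating solitons\<close>

text \<open>Here \<open>X\<close> is a local parametrization defined on \<open>S\<close>. In the charts of an oriented atlas the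
  values agree on overlaps and define the Gauss map of the oriented immersed surface.\<close>

definition gauss_map :: "(real^2) set \<Rightarrow> (real^2 \<Rightarrow> real^3) \<Rightarrow> real^2 \<Rightarrow> real^3" where
  "gauss_map S X u =
     (let n = cross3 (diff_on S X u (axis 1 1)) (diff_on S X u (axis 2 1)) in n /\<^sub>R norm n)"

text \<open>\<open>k\<^sub>1\<close> and \<open>k\<^sub>2\<close> are the eigenvalues, counted with multiplicity, of the shape
  operator \<open>-dN\<close>. The vectors \<open>w\<^sub>1\<close> and \<open>w\<^sub>2\<close> are principal directions in coordinates. With
  this sign, the inward Gauss map of the unit sphere gives \<open>k\<^sub>1 = k\<^sub>2 = 1\<close>, in accordance
  with \<open>\<Delta>\<psi> = 2HN\<close>.\<close>

definition principal_curvatures ::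
  "(real^2) set \<Rightarrow> (real^2 \<Rightarrow> real^3) \<Rightarrow> real^2 \<Rightarrow> real \<Rightarrow> real \<Rightarrow> bool" where
  "principal_curvatures S X u k\<^sub>1 k\<^sub>2 \<longleftrightarrow>
     (\<exists>w\<^sub>1 w\<^sub>2. w\<^sub>1 \<noteq> w\<^sub>2 \<and> independent {w\<^sub>1, w\<^sub>2} \<and>
        - diff_on S (gauss_map S X) u w\<^sub>1 = k\<^sub>1 *\<^sub>R diff_on S X u w\<^sub>1 \<and>
        - diff_on S (gauss_map S X) u w\<^sub>2 = k\<^sub>2 *\<^sub>R diff_on S X u w\<^sub>2)"

definition has_mean_curvature ::
  "(real^2) set \<Rightarrow> (real^2 \<Rightarrow> real^3) \<Rightarrow> real^2 \<Rightarrow> real \<Rightarrow> bool" where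
  "has_mean_curvature S X u H \<longleftrightarrow>
     (\<exists>k\<^sub>1 k\<^sub>2. principal_curvatures S X u k\<^sub>1 k\<^sub>2 \<and> H = (k\<^sub>1 + k\<^sub>2) / 2)"

definition translating_soliton ::
  "real^3 \<Rightarrow> 'a topology \<Rightarrow> 'a chart set \<Rightarrow> ('a \<Rightarrow> real^3) \<Rightarrow> bool" where
  "translating_soliton v M A \<psi> \<longleftrightarrow>
     oriented_surface M A \<and> immersion A \<psi> \<and>
     (\<forall>c\<in>A. \<forall>u\<in>chart_image c.
        let S = chart_image c; X = local_param \<psi> c in
        has_mean_curvature S X u ((gauss_map S X u \<bullet> v) / 2))"


section \<open>Planes in space\<close>

definition plane :: "real^3 \<Rightarrow> real \<Rightarrow> (real^3) set" where
  "plane a b = {x. a \<bullet> x = b}"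

text \<open>The linear plane of all vectors parallel to \<open>plane a b\<close>.\<close>

definition plane_direction :: "real^3 \<Rightarrow> (real^3) set" where
  "plane_direction a = {w. a \<bullet> w = 0}"

end

theory Submission
  imports Defs
begin

text \<open>
  Let \<open>w\<close> be a vector with \<open>w \<bullet> v > 0\<close>. The height \<open>w \<bullet> \<psi>\<close> has no maximum at a point where the
  surface is orthogonal to \<open>w\<close>: there \<open>w = \<lambda> N\<close>, and the second derivative of the height along a
  principal direction \<open>w\<^sub>i\<close> is \<open>\<lambda> k\<^sub>i |d\<psi> w\<^sub>i|\<^sup>2 \<le> 0\<close>, so that
  \<open>w \<bullet> v = \<lambda> N \<bullet> v = \<lambda> (k\<^sub>1 + k\<^sub>2) \<le> 0\<close>. A one-sided second derivative test suffices, so this covers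
  boundary points of tangency as well as interior points, and no Hopf lemma is needed. If \<open>\<Pi>\<close> is
  not parallel to \<open>v\<close>, take \<open>w\<close> normal to \<open>\<Pi>\<close>; otherwise take \<open>w = \<plusminus>a + \<epsilon> v\<close> and let
  \<open>\<epsilon> \<rightarrow> 0\<close>.
\<close>

section \<open>One-sided calculus on relatively open subsets of the half-plane\<close>

text \<open>If \<open>D\<close> were positive, \<open>h'\<close> would be positive just to the right
  of 0, and \<open>h\<close> would increase there. The maximum is assumed only on the right because
  a ray from a boundary point may stay in the half-plane only for \<open>t \<ge> 0\<close>; the
  derivatives are two-sided because \<open>h\<close> will come from a smooth extension.\<close>

lemma second_derivative_nonpos_right:
  fixes h h' :: "real \<Rightarrow> real"
  assumes e: "0 < e"
    and h: "\<And>t. 0 \<le> t \<Longrightarrow> t < e \<Longrightarrow> (h has_real_derivative h' t) (at t)"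
    and h'0: "h' 0 = 0"
    and h'': "(h' has_real_derivative D) (at 0)"
    and max: "\<And>t. 0 < t \<Longrightarrow> t < e \<Longrightarrow> h t \<le> h 0"
  shows "D \<le> 0"
proof (rule ccontr)
  assume "\<not> D \<le> 0"
  then obtain d where d: "d > 0" "\<And>t. 0 < t \<Longrightarrow> t < d \<Longrightarrow> 0 < h' t"
    using DERIV_pos_inc_right[OF h''] h'0 by auto
  define t where "t = min d e / 2"
  have t: "0 < t" "t < d" "t < e"
    using d(1) e by (auto simp: t_def min_def)
  have "h 0 < h t"
  proof (rule DERIV_pos_imp_increasing_open[OF t(1)])
    show "\<exists>y. (h has_real_derivative y) (at x) \<and> 0 < y" if "0 < x" "x < t" for x
      using that h[of x] d(2)[of x] t by auto
    show "continuous_on {0..t} h"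
    proof (intro continuous_at_imp_continuous_on ballI)
      show "isCont h x" if "x \<in> {0..t}" for x
        using DERIV_isCont[OF h[of x]] that t by simp
    qed
  qed
  with max[OF t(1,3)] show False by simp
qed

lemma openin_halfplane_ray:
  assumes S: "openin (top_of_set halfplane) S" and u: "u \<in> S" and \<xi>: "0 \<le> \<xi> $ 2"
  obtains e where "0 < e" "\<And>t. 0 \<le> t \<Longrightarrow> t < e \<Longrightarrow> u + t *\<^sub>R \<xi> \<in> S"
proof -
  obtain T where T: "open T" "S = halfplane \<inter> T"
    using S by (auto simp: openin_open)
  obtain r where r: "r > 0" "ball u r \<subseteq> T"
    using T u open_contains_ball by blast
  \<comment> \<open>The summand 1 keeps the denominator positive when
    \<open>\<xi> = 0\<close>.\<close>
  define e where "e = r / (norm \<xi> + 1)"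
  show thesis
  proof
    show "0 < e" using r by (simp add: e_def add_nonneg_pos)
    fix t assume t: "0 \<le> t" "t < e"
    have "t * norm \<xi> \<le> t * (norm \<xi> + 1)" using t by (simp add: mult_left_mono)
    also have "\<dots> < r"
      using t(2) by (simp add: e_def add_nonneg_pos pos_less_divide_eq)
    finally have "u + t *\<^sub>R \<xi> \<in> ball u r"
      using t by (simp add: dist_norm)
    moreover have "u + t *\<^sub>R \<xi> \<in> halfplane"
      using u T \<xi> t by (simp add: halfplane_def)
    ultimately show "u + t *\<^sub>R \<xi> \<in> S" using r T by auto
  qed
qed

text \<open>Both coordinate vectors have a nonnegative second entry, so short segments from
  \<open>u\<close> along them stay in \<open>S\<close>. This determines the derivative, even on the
  boundary line.\<close>

lemma frechet_derivative_within_halfplane: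
  assumes S: "openin (top_of_set halfplane) S" and u: "u \<in> S"
    and f: "(f has_derivative f') (at u within S)"
  shows "frechet_derivative f (at u within S) = f'"
proof (rule frechet_derivative_unique_within[OF _ f])
  show "(f has_derivative frechet_derivative f (at u within S)) (at u within S)"
    using f by (meson differentiable_def frechet_derivative_works)
  fix i :: "real^2" and e :: real
  assume i: "i \<in> Basis" and e: "e > 0"
  obtain k where "i = axis k 1"
    using i by (auto simp: Basis_vec_def)
  then have "0 \<le> i $ 2" by (simp add: axis_def)
  then obtain e' where e': "0 < e'" "\<And>t. 0 \<le> t \<Longrightarrow> t < e' \<Longrightarrow> u + t *\<^sub>R i \<in> S"
    using openin_halfplane_ray[OF S u] by blast
  with e show "\<exists>d. 0 < \<bar>d\<bar> \<and> \<bar>d\<bar> < e \<and> u + d *\<^sub>R i \<in> S"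
    by (intro exI[of _ "min e e' / 2"]) (auto simp: min_def)
qed

text \<open>Moves every computation to a smooth extension on an open set, where ordinary two-sided
  calculus is available.\<close>

lemma frechet_derivative_within_extension:
  assumes S: "openin (top_of_set halfplane) S" and u: "u \<in> S" "u \<in> W" "open W"
    and g: "g differentiable (at u)" and eq: "\<And>y. y \<in> S \<inter> W \<Longrightarrow> g y = f y"
  shows "frechet_derivative f (at u within S) = frechet_derivative g (at u)"
proof (rule frechet_derivative_within_halfplane[OF S u(1)])
  obtain r where r: "r > 0" "ball u r \<subseteq> W"
    using u open_contains_ball by blast
  have "(g has_derivative frechet_derivative g (at u)) (at u within S)"
    using g frechet_derivative_works has_derivative_at_withinI by blast
  then show "(f has_derivative frechet_derivative g (at u)) (at u within S)"
  proof (rule has_derivative_transform_within[OF _ r(1) u(1)])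
    show "g x = f x" if "x \<in> S" "dist x u < r" for x
      using that r by (intro eq) (auto simp: dist_commute)
  qed
qed

lemma interior_max_orthogonal:
  assumes S: "openin (top_of_set halfplane) S" and u: "u \<in> S" "u $ 2 \<noteq> 0"
    and X: "smooth_on S X"
    and max: "\<And>y. y \<in> S \<Longrightarrow> w \<bullet> X y \<le> w \<bullet> X u"
  shows "w \<bullet> diff_on S X u \<xi> = 0"
proof -
  obtain W g where W: "open W" "u \<in> W" and Ck': "\<forall>k. Ck_on k W g"
    and eq': "\<forall>y\<in>S \<inter> W. g y = X y"
    using bspec[OF X[unfolded smooth_on_def] u(1)] by (elim exE conjE)
  note Ck = Ck'[rule_format] and eq = eq'[rule_format]
  have g: "g differentiable (at u)"
    using Ck[of "Suc 0"] W by simp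
  obtain T where T: "open T" "S = halfplane \<inter> T"
    using S by (auto simp: openin_open)
  \<comment> \<open>A neighbourhood of \<open>u\<close> that is open in the whole plane and on which
    \<open>g\<close> equals \<open>X\<close>, so that Fermat's criterion applies to
    \<open>g\<close>.\<close>
  define P where "P = {x::real^2. 0 < x $ 2} \<inter> T \<inter> W"
  have "open {x::real^2. 0 < x $ 2}"
    by (simp add: open_halfspace_component_gt_cart)
  then have "open P" unfolding P_def using T W by blast
  have PS: "P \<subseteq> S \<inter> W" by (auto simp: P_def T halfplane_def)
  have uP: "u \<in> P"
    using u W T by (auto simp: P_def halfplane_def)
  have "((\<lambda>x. w \<bullet> g x) has_derivative (\<lambda>\<xi>. w \<bullet> frechet_derivative g (at u) \<xi>)) (at u)"
    using g frechet_derivative_works by (auto intro!: derivative_intros)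
  moreover have "\<forall>y\<in>P. w \<bullet> g y \<le> w \<bullet> g u"
    using PS uP max eq by (metis IntE subsetD)
  ultimately have "(\<lambda>\<xi>. w \<bullet> frechet_derivative g (at u) \<xi>) = (\<lambda>_. 0)"
    using differential_zero_maxmin[OF uP \<open>open P\<close>] by blast
  then show ?thesis
    using frechet_derivative_within_extension[OF S u(1) W(2,1) g eq] by metis
qed

section \<open>Linear algebra for normal vectors, and the second-order estimate at a point\<close>

lemma linear_real2_combination:
  fixes f :: "real^2 \<Rightarrow> 'b::real_vector"
  assumes "linear f"
  shows "f \<xi> = \<xi> $ 1 *\<^sub>R f (axis 1 1) + \<xi> $ 2 *\<^sub>R f (axis 2 1)"
proof -
  have "\<xi> = \<xi> $ 1 *\<^sub>R axis 1 1 + \<xi> $ 2 *\<^sub>R axis 2 1"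
    by (simp add: vec_eq_iff forall_2 axis_def)
  then have "f \<xi> = f (\<xi> $ 1 *\<^sub>R axis 1 1 + \<xi> $ 2 *\<^sub>R axis 2 1)"
    by (rule arg_cong)
  then show ?thesis
    by (simp only: linear_add[OF assms] linear_scale[OF assms])
qed

text \<open>By the triple product expansion the cross product of \<open>w\<close> with
  \<open>cross3 x y\<close> vanishes.\<close>

lemma parallel_cross3:
  assumes "w \<bullet> x = 0" "w \<bullet> y = 0" "cross3 x y \<noteq> 0"
  obtains c where "w = c *\<^sub>R cross3 x y"
proof -
  have "cross3 w (cross3 x y) = (w \<bullet> y) *\<^sub>R x - (w \<bullet> x) *\<^sub>R y"
    by (simp add: cross3_simps forall_3)
  then have "collinear {0, cross3 x y, w}"
    using assms by (simp add: cross_eq_0 insert_commute)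
  then show thesis
    using assms(3) that by (auto simp: collinear_lemma)
qed

text \<open>With \<open>w = \<lambda> N\<close>, differentiating \<open>N \<bullet> dX \<xi> = 0\<close> along \<open>\<xi>\<close> identifies the second derivative
  of \<open>w \<bullet> X\<close> with \<open>\<lambda> (- dN \<xi>) \<bullet> dX \<xi>\<close>.\<close>

lemma soliton_max_orthogonal:
  assumes S: "openin (top_of_set halfplane) S" and u: "u \<in> S"
    and X: "smooth_on S X"
    and inj: "inj (diff_on S X u)"
    and H: "has_mean_curvature S X u ((gauss_map S X u \<bullet> v) / 2)"
    and orth: "\<And>\<xi>. w \<bullet> diff_on S X u \<xi> = 0"
    and max: "\<And>y. y \<in> S \<Longrightarrow> w \<bullet> X y \<le> w \<bullet> X u"
  shows "w \<bullet> v \<le> 0"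
proof -
  obtain W g where W: "open W" "u \<in> W" and Ck': "\<forall>k. Ck_on k W g"
    and eq': "\<forall>y\<in>S \<inter> W. g y = X y"
    using bspec[OF X[unfolded smooth_on_def] u] by (elim exE conjE)
  note Ck = Ck'[rule_format] and eq = eq'[rule_format]
  \<comment> \<open>Derivatives are those of the extension \<open>g\<close>; on
    \<open>S \<inter> W\<close> the differential agrees with the one taken within \<open>S\<close>.
    \<open>D2 \<xi> \<xi>\<close> is the second derivative of \<open>g\<close> at \<open>u\<close>
    along \<open>\<xi>\<close>.\<close>
  define D where "D x = frechet_derivative g (at x)" for x
  define D2 where "D2 \<xi> = frechet_derivative (\<lambda>x. D x \<xi>) (at u)" for \<xi>
  have g: "g differentiable (at x)" if "x \<in> W" for x
    using Ck[of "Suc 0"] that by simp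
  have Dg: "(g has_derivative D x) (at x)" if "x \<in> W" for x
    using g[OF that] frechet_derivative_works D_def by metis
  have DD: "((\<lambda>x. D x \<xi>) has_derivative D2 \<xi>) (at u)" for \<xi>
    using Ck[of "Suc (Suc 0)"] W frechet_derivative_works[of "\<lambda>x. D x \<xi>" "at u"]
    unfolding D_def D2_def by simp
  have linD: "linear (D x)" if "x \<in> W" for x
    using Dg[OF that] has_derivative_linear by blast
  have D_eq: "diff_on S X y = D y" if "y \<in> S \<inter> W" for y
    unfolding D_def
    using frechet_derivative_within_extension[OF S _ _ W(1) g eq] that by auto

  define n where "n x = cross3 (D x (axis 1 1)) (D x (axis 2 1))" for x
  define N where "N x = n x /\<^sub>R norm (n x)" for x
  have N_eq: "N y = gauss_map S X y" if "y \<in> S \<inter> W" for y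
    using D_eq[OF that] by (simp add: gauss_map_def N_def n_def Let_def)
  \<comment> \<open>This holds on all of \<open>W\<close>, even where \<open>g\<close> fails to be
    an immersion: there \<open>n x = 0\<close> and hence \<open>N x = 0\<close>. The identity can
    therefore be differentiated at \<open>u\<close> in every direction.\<close>
  have N_orth: "N x \<bullet> D x \<xi> = 0" if "x \<in> W" for x \<xi>
    unfolding linear_real2_combination[OF linD[OF that], of \<xi>]
    by (simp add: N_def n_def inner_add_right dot_cross_self)
  have injD: "inj (D u)" using inj D_eq u W by simp
  have nu: "n u \<noteq> 0"
  proof
    assume "n u = 0"
    then have "collinear {0, D u (axis 1 1), D u (axis 2 1)}"
      by (simp add: n_def cross_eq_0)
    moreover have "D u (axis 1 1) \<noteq> 0"
      using injD linD[OF W(2)] by (metis axis_eq_0_iff linear_injective_0 zero_neq_one)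
    ultimately obtain c where "D u (axis 2 1) = c *\<^sub>R D u (axis 1 1)"
      by (auto simp: collinear_lemma)
    then have "D u (axis 2 1) = D u (c *\<^sub>R axis 1 1)"
      using linD[OF W(2)] by (simp add: linear_scale)
    then have "axis 2 1 = (c *\<^sub>R axis 1 1 :: real^2)"
      using injD by (simp add: inj_eq)
    then show False by (auto simp: vec_eq_iff forall_2 axis_def)
  qed
  have "bounded_bilinear cross3"
    using bilinear_cross bilinear_conv_bounded_bilinear by blast
  then have "n differentiable (at u)"
    unfolding n_def using DD bounded_bilinear.FDERIV differentiable_def by blast
  moreover have "(\<lambda>x. norm (n x)) differentiable (at u)"
    using differentiable_chain_at[OF calculation differentiable_norm_at[OF nu]]
    by (simp add: o_def)
  ultimately have Ndiff: "N differentiable (at u)"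
    unfolding N_def using nu by (auto intro!: differentiable_scaleR differentiable_inverse)
  define DN where "DN = frechet_derivative N (at u)"
  have DN: "(N has_derivative DN) (at u)"
    using Ndiff frechet_derivative_works DN_def by metis
  have DN_eq: "diff_on S (gauss_map S X) u = DN"
    unfolding DN_def
    using frechet_derivative_within_extension[OF S u W(2,1) Ndiff N_eq] .

  have weingarten: "N u \<bullet> D2 \<xi> \<xi> = (- DN \<xi>) \<bullet> D u \<xi>" for \<xi>
  proof -
    have "((\<lambda>x. N x \<bullet> D x \<xi>) has_derivative (\<lambda>h. N u \<bullet> D2 \<xi> h + DN h \<bullet> D u \<xi>)) (at u)"
      by (rule has_derivative_inner[OF DN DD])
    moreover have "((\<lambda>x. N x \<bullet> D x \<xi>) has_derivative (\<lambda>h. 0)) (at u)"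
      by (rule has_derivative_transform_within_open[OF has_derivative_const W, of 0])
        (simp add: N_orth)
    ultimately have "(\<lambda>h. N u \<bullet> D2 \<xi> h + DN h \<bullet> D u \<xi>) = (\<lambda>h. 0)"
      by (rule has_derivative_unique)
    then have "N u \<bullet> D2 \<xi> \<xi> + DN \<xi> \<bullet> D u \<xi> = 0" by meson
    then show ?thesis by simp
  qed

  \<comment> \<open>For such \<open>\<xi>\<close> a short ray from \<open>u\<close> stays in
    \<open>S \<inter> W\<close>, so \<open>max\<close> bounds the height along it. The first
    derivative vanishes by \<open>orth\<close>, and the one-sided test applies.\<close>
  have hess_up: "w \<bullet> D2 \<xi> \<xi> \<le> 0" if \<xi>: "0 \<le> \<xi> $ 2" for \<xi>
  proof -
    obtain e1 where e1: "0 < e1" "\<And>t. 0 \<le> t \<Longrightarrow> t < e1 \<Longrightarrow> u + t *\<^sub>R \<xi> \<in> S"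
      using openin_halfplane_ray[OF S u \<xi>] by blast
    have "open ((\<lambda>t. u + t *\<^sub>R \<xi>) -` W)"
      using W by (intro open_vimage continuous_intros)
    then obtain e2 where e2: "0 < e2" "ball 0 e2 \<subseteq> (\<lambda>t. u + t *\<^sub>R \<xi>) -` W"
      using W(2) open_contains_ball by (metis (no_types, lifting) add.right_neutral scaleR_zero_left vimageI)
    define e where "e = min e1 e2"
    have inW: "u + t *\<^sub>R \<xi> \<in> W" if "0 \<le> t" "t < e" for t
      using e2(2) that by (auto simp: e_def subset_iff)
    have line: "((\<lambda>t. u + t *\<^sub>R \<xi>) has_derivative (\<lambda>h. h *\<^sub>R \<xi>)) (at t)" for t
      by (auto intro!: derivative_eq_intros)
    show ?thesis
    proof (rule second_derivative_nonpos_right)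
      show "0 < e" using e1 e2 by (simp add: e_def)
      show "((\<lambda>t. w \<bullet> g (u + t *\<^sub>R \<xi>)) has_real_derivative w \<bullet> D (u + t *\<^sub>R \<xi>) \<xi>) (at t)"
        if "0 \<le> t" "t < e" for t
      proof -
        have "((\<lambda>t. w \<bullet> g (u + t *\<^sub>R \<xi>)) has_derivative
            (\<lambda>h. w \<bullet> D (u + t *\<^sub>R \<xi>) (h *\<^sub>R \<xi>))) (at t)"
          by (rule has_derivative_inner_right[OF has_derivative_compose[OF line Dg]])
            (use inW that in auto)
        then show ?thesis
          by (rule has_derivative_imp_has_field_derivative)
            (simp add: linear_scale[OF linD[OF inW[OF that]]])
      qed
      have "((\<lambda>t. w \<bullet> D (u + t *\<^sub>R \<xi>) \<xi>) has_derivative (\<lambda>h. w \<bullet> D2 \<xi> (h *\<^sub>R \<xi>))) (at 0)"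
        using has_derivative_inner_right[OF has_derivative_compose[OF line, of "\<lambda>x. D x \<xi>" "D2 \<xi>" 0]] DD
        by simp
      then show "((\<lambda>t. w \<bullet> D (u + t *\<^sub>R \<xi>) \<xi>) has_real_derivative w \<bullet> D2 \<xi> \<xi>) (at 0)"
        by (rule has_derivative_imp_has_field_derivative)
          (simp add: linear_scale[OF has_derivative_linear[OF DD]])
      show "w \<bullet> D (u + 0 *\<^sub>R \<xi>) \<xi> = 0"
        using orth[of \<xi>] D_eq[of u] u W by simp
      show "w \<bullet> g (u + t *\<^sub>R \<xi>) \<le> w \<bullet> g (u + 0 *\<^sub>R \<xi>)" if "0 < t" "t < e" for t
      proof -
        have "u + t *\<^sub>R \<xi> \<in> S \<inter> W"
          using that inW[of t] e1(2)[of t] by (auto simp: e_def)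
        then show ?thesis using max eq u W by auto
      qed
    qed
  qed
  \<comment> \<open>The second derivative is even in the direction, which reduces directions
    pointing out of the half-plane to their opposites.\<close>
  have D2_minus: "D2 (- \<xi>) (- \<xi>) = D2 \<xi> \<xi>" for \<xi>
  proof -
    have "((\<lambda>x. D x (- \<xi>)) has_derivative (\<lambda>h. - D2 \<xi> h)) (at u)"
      by (rule has_derivative_transform_within_open[OF has_derivative_minus[OF DD] W])
        (simp add: linear_neg linD)
    then have "D2 (- \<xi>) = (\<lambda>h. - D2 \<xi> h)"
      using DD has_derivative_unique by blast
    then show ?thesis
      using has_derivative_linear[OF DD] by (simp add: linear_neg)
  qed
  have hess: "w \<bullet> D2 \<xi> \<xi> \<le> 0" for \<xi>
    using hess_up[of \<xi>] hess_up[of "- \<xi>"] D2_minus[of \<xi>] by fastforce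

  have "w \<bullet> D u \<xi> = 0" for \<xi>
    using orth[of \<xi>] D_eq[of u] u W by simp
  then obtain c where "w = c *\<^sub>R n u"
    using parallel_cross3[of w "D u (axis 1 1)" "D u (axis 2 1)"] nu unfolding n_def by blast
  then have w: "w = (c * norm (n u)) *\<^sub>R N u"
    using nu by (simp add: N_def)
  \<comment> \<open>Now \<open>w = l *\<^sub>R N u\<close>. The sign of \<open>l\<close> is unknown,
    so only its products with the principal curvatures are estimated.\<close>
  define l where "l = c * norm (n u)"
  have curv: "l * k \<le> 0" if "- DN \<xi> = k *\<^sub>R D u \<xi>" "\<xi> \<noteq> 0" for k \<xi>
  proof -
    have "l * k * (D u \<xi> \<bullet> D u \<xi>) = l * ((- DN \<xi>) \<bullet> D u \<xi>)"
      using that(1) by simp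
    also have "\<dots> = w \<bullet> D2 \<xi> \<xi>"
      using weingarten[of \<xi>] w by (simp add: l_def)
    finally have "l * k * (D u \<xi> \<bullet> D u \<xi>) \<le> 0"
      using hess by simp
    moreover have "0 < D u \<xi> \<bullet> D u \<xi>"
      using injD linD[OF W(2)] that(2) by (metis inner_gt_zero_iff linear_injective_0)
    ultimately show ?thesis by (simp add: mult_le_0_iff)
  qed
  obtain k1 k2 w1 w2 where k: "(gauss_map S X u \<bullet> v) / 2 = (k1 + k2) / 2"
    and ind: "independent {w1, w2}"
    and pc: "- DN w1 = k1 *\<^sub>R D u w1" "- DN w2 = k2 *\<^sub>R D u w2"
    using H D_eq[of u] DN_eq u W
    unfolding has_mean_curvature_def principal_curvatures_def by auto
  have "w1 \<noteq> 0" "w2 \<noteq> 0"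
    using ind dependent_zero by blast+
  with pc curv have "l * k1 \<le> 0" "l * k2 \<le> 0" by blast+
  \<comment> \<open>Twice the soliton equation is \<open>k1 + k2 = N u \<bullet> v\<close>.\<close>
  moreover have "w \<bullet> v = l * k1 + l * k2"
    using w k N_eq[of u] u W by (simp add: l_def field_simps)
  ultimately show ?thesis by simp
qed

section \<open>Charts and continuity of the immersion\<close>

lemma chart_param:
  assumes c: "is_chart M (U, \<phi>)" and p: "p \<in> U"
  shows "\<phi> p \<in> chart_image (U, \<phi>)" "local_param \<psi> (U, \<phi>) (\<phi> p) = \<psi> p" "p \<in> topspace M"
proof -
  have U: "openin M U" and hom: "homeomorphic_map (subtopology M U) (top_of_set (\<phi> ` U)) \<phi>"
    using c by (auto simp: is_chart_def)
  then have "inj_on \<phi> U"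
    using openin_subset[OF U]
    by (auto simp: homeomorphic_eq_everything_map Int_absorb1)
  then show "local_param \<psi> (U, \<phi>) (\<phi> p) = \<psi> p"
    using p by (simp add: local_param_def)
  show "\<phi> p \<in> chart_image (U, \<phi>)" using p by (simp add: chart_image_def)
  show "p \<in> topspace M" using openin_subset[OF U] p by blast
qed

lemma surface_boundary_subset:
  assumes "oriented_surface M A"
  shows "surface_boundary A \<subseteq> topspace M"
proof -
  have "surface_boundary A \<subseteq> (\<Union>c\<in>A. fst c)"
    by (force simp: surface_boundary_def)
  then show ?thesis using assms by (simp add: oriented_surface_def)
qed

lemma smooth_on_imp_continuous_on:
  assumes "smooth_on S f"
  shows "continuous_on S f"
  unfolding continuous_on_eq_continuous_within
proof
  fix x assume x: "x \<in> S"
  obtain W g where W: "open W" "x \<in> W" and Ck': "\<forall>k. Ck_on k W g"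
    and eq': "\<forall>y\<in>S \<inter> W. g y = f y"
    using bspec[OF assms[unfolded smooth_on_def] x] by (elim exE conjE)
  note Ck = Ck'[rule_format] and eq = eq'[rule_format]
  obtain r where r: "r > 0" "ball x r \<subseteq> W"
    using W open_contains_ball by blast
  have "continuous_on W g" using Ck[of 0] by simp
  then have "continuous (at x within S) g"
    using W continuous_on_eq_continuous_at continuous_at_imp_continuous_at_within by blast
  then show "continuous (at x within S) f"
    by (rule continuous_transform_within[OF _ r(1) x])
      (use r in \<open>auto intro!: eq simp: dist_commute\<close>)
qed

text \<open>On a chart domain \<open>\<psi>\<close> is the local parametrization after the chart
  map; these continuous restrictions are pasted over the open cover by chart domains. Compactness of
  the image will follow.\<close>

lemma immersion_continuous_map:
  assumes surf: "oriented_surface M A" and imm: "immersion A \<psi>"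
  shows "continuous_map M euclidean \<psi>"
proof (rule pasting_lemma[where I = A and T = fst and f = "\<lambda>_. \<psi>"])
  fix c assume c: "c \<in> A"
  obtain U \<phi> where U: "c = (U, \<phi>)" by (cases c)
  have ch: "is_chart M (U, \<phi>)" using surf c U by (auto simp: oriented_surface_def)
  then show "openin M (fst c)" using U by (simp add: is_chart_def)
  have "continuous_map (subtopology M U) (top_of_set (\<phi> ` U)) \<phi>"
    using ch homeomorphic_imp_continuous_map by (auto simp: is_chart_def)
  moreover have "continuous_map (top_of_set (\<phi> ` U)) euclidean (local_param \<psi> c)"
    using imm c smooth_on_imp_continuous_on U
    by (fastforce simp: immersion_def chart_image_def)
  ultimately have "continuous_map (subtopology M U) euclidean (local_param \<psi> c \<circ> \<phi>)"
    by (rule continuous_map_compose)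
  then have "continuous_map (subtopology M U) euclidean \<psi>"
    by (rule continuous_map_eq) (use chart_param(2)[OF ch] U in auto)
  then show "continuous_map (subtopology M (fst c)) euclidean \<psi>"
    by (simp add: U)
next
  fix x assume "x \<in> topspace M"
  then have "x \<in> (\<Union>c\<in>A. fst c)"
    using surf by (simp add: oriented_surface_def)
  then show "\<exists>j. j \<in> A \<and> x \<in> fst j \<and> \<psi> x = \<psi> x"
    by blast
qed auto

section \<open>Maxima of height functions on solitons\<close>

context
  fixes M :: "'a topology" and A :: "'a chart set" and \<psi> :: "'a \<Rightarrow> real^3" and v w :: "real^3"
  assumes soliton: "translating_soliton v M A \<psi>" and wv: "0 < w \<bullet> v"
begin

text \<open>A maximum over the surface is a maximum in each chart around \<open>p\<close>, so the
  pointwise estimate contradicts \<open>wv\<close>. Boundary points are included.\<close>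

lemma soliton_no_orthogonal_max:
  assumes c: "c \<in> A" and p: "p \<in> fst c"
    and orth: "\<And>\<xi>. w \<bullet> diff_on (chart_image c) (local_param \<psi> c) (snd c p) \<xi> = 0"
    and max: "\<And>q. q \<in> topspace M \<Longrightarrow> w \<bullet> \<psi> q \<le> w \<bullet> \<psi> p"
  shows False
proof -
  obtain U \<phi> where U: "c = (U, \<phi>)" by (cases c)
  have surf: "oriented_surface M A" and imm: "immersion A \<psi>"
    and H: "\<And>u. u \<in> chart_image c \<Longrightarrow> has_mean_curvature (chart_image c) (local_param \<psi> c) u
        ((gauss_map (chart_image c) (local_param \<psi> c) u \<bullet> v) / 2)"
    using soliton c by (auto simp: translating_soliton_def Let_def)
  have ch: "is_chart M (U, \<phi>)" using surf c U by (auto simp: oriented_surface_def)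
  have S: "openin (top_of_set halfplane) (chart_image c)"
    using ch U by (simp add: is_chart_def chart_image_def)
  note cp = chart_param[OF ch]
  have u: "snd c p \<in> chart_image c" using cp(1) p U by simp
  have "w \<bullet> v \<le> 0"
  proof (rule soliton_max_orthogonal[OF S u _ _ H[OF u] orth])
    show "smooth_on (chart_image c) (local_param \<psi> c)"
      using imm c by (simp add: immersion_def)
    show "inj (diff_on (chart_image c) (local_param \<psi> c) (snd c p))"
      using imm c u by (simp add: immersion_def)
    fix y assume "y \<in> chart_image c"
    then obtain q where "q \<in> U" "y = \<phi> q" by (auto simp: U chart_image_def)
    then show "w \<bullet> local_param \<psi> c y \<le> w \<bullet> local_param \<psi> c (snd c p)"
      using cp(2,3) max p U by simp
  qed
  with wv show False by simp
qed

text \<open>In a chart an interior point lies off the boundary line, so the height is critical there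
  and the surface is orthogonal to \<open>w\<close>.\<close>

lemma soliton_no_interior_max:
  assumes p: "p \<in> surface_interior M A"
    and max: "\<And>q. q \<in> topspace M \<Longrightarrow> w \<bullet> \<psi> q \<le> w \<bullet> \<psi> p"
  shows False
proof -
  have surf: "oriented_surface M A" and imm: "immersion A \<psi>"
    using soliton by (auto simp: translating_soliton_def)
  have "p \<in> (\<Union>c\<in>A. fst c)"
    using p surf by (simp add: oriented_surface_def surface_interior_def)
  then obtain U \<phi> where c: "(U, \<phi>) \<in> A" and pU: "p \<in> U" by auto
  have ch: "is_chart M (U, \<phi>)" using surf c by (auto simp: oriented_surface_def)
  have S: "openin (top_of_set halfplane) (chart_image (U, \<phi>))"
    using ch by (simp add: is_chart_def chart_image_def)
  note cp = chart_param[OF ch]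
  have "\<phi> p $ 2 \<noteq> 0"
    using p c pU by (auto simp: surface_interior_def surface_boundary_def)
  moreover have "smooth_on (chart_image (U, \<phi>)) (local_param \<psi> (U, \<phi>))"
    using imm c by (auto simp: immersion_def)
  moreover have "w \<bullet> local_param \<psi> (U, \<phi>) y \<le> w \<bullet> local_param \<psi> (U, \<phi>) (\<phi> p)"
    if y: "y \<in> chart_image (U, \<phi>)" for y
  proof -
    obtain q where "q \<in> U" "y = \<phi> q" using y by (auto simp: chart_image_def)
    then show ?thesis using cp(2,3) max pU by simp
  qed
  ultimately have "w \<bullet> diff_on (chart_image (U, \<phi>)) (local_param \<psi> (U, \<phi>)) (\<phi> p) \<xi> = 0" for \<xi>
    using interior_max_orthogonal[OF S cp(1)[OF pU]] by blast
  with soliton_no_orthogonal_max[OF c, of p] pU max show False by simp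
qed

text \<open>Compactness provides a maximum point, which cannot be interior.\<close>

lemma soliton_max_on_boundary:
  assumes cpt: "compact_space M" and ne: "topspace M \<noteq> {}"
  obtains q where "q \<in> surface_boundary A" "\<And>p. p \<in> topspace M \<Longrightarrow> w \<bullet> \<psi> p \<le> w \<bullet> \<psi> q"
proof -
  have "continuous_map M euclidean \<psi>"
    using soliton immersion_continuous_map by (auto simp: translating_soliton_def)
  then have "compact (\<psi> ` topspace M)"
    using image_compactin cpt by (fastforce simp: compact_space_def)
  then obtain x where "x \<in> \<psi> ` topspace M" "\<forall>y\<in>\<psi> ` topspace M. w \<bullet> y \<le> w \<bullet> x"
    using continuous_attains_sup[of "\<psi> ` topspace M" "\<lambda>x. w \<bullet> x"] ne
      continuous_on_inner[OF continuous_on_const continuous_on_id] by (metis image_is_empty)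
  then obtain q where q: "q \<in> topspace M" "\<And>p. p \<in> topspace M \<Longrightarrow> w \<bullet> \<psi> p \<le> w \<bullet> \<psi> q"
    by auto
  with soliton_no_interior_max have "q \<in> surface_boundary A"
    by (auto simp: surface_interior_def)
  with q that show thesis by blast
qed

text \<open>The maximum is attained on the boundary, hence equals \<open>b\<close>. An interior
  point at height \<open>b\<close>, or a boundary point with tangent plane orthogonal to
  \<open>w\<close>, would be one of the excluded maxima.\<close>

lemma soliton_one_side:
  assumes cpt: "compact_space M"
    and bd: "\<And>q. q \<in> surface_boundary A \<Longrightarrow> w \<bullet> \<psi> q = b"
  shows "p \<in> surface_interior M A \<Longrightarrow> w \<bullet> \<psi> p < b"
    and "p \<in> surface_boundary A \<Longrightarrow> tangent_plane A \<psi> p \<noteq> plane_direction w"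
proof -
  have le: "w \<bullet> \<psi> p \<le> b" if "p \<in> topspace M" for p
    using soliton_max_on_boundary[OF cpt] bd that by (metis empty_iff)
  show "w \<bullet> \<psi> p < b" if "p \<in> surface_interior M A"
    using soliton_no_interior_max[OF that] le that
    by (metis DiffD1 linorder_not_less order_trans surface_interior_def)
  show "tangent_plane A \<psi> p \<noteq> plane_direction w" if p: "p \<in> surface_boundary A"
  proof
    assume eq: "tangent_plane A \<psi> p = plane_direction w"
    obtain c where c: "c \<in> A" "p \<in> fst c"
      using p by (fastforce simp: surface_boundary_def)
    then have "range (diff_on (chart_image c) (local_param \<psi> c) (snd c p)) \<subseteq> tangent_plane A \<psi> p"
      unfolding tangent_plane_def by blast
    then have "w \<bullet> diff_on (chart_image c) (local_param \<psi> c) (snd c p) \<xi> = 0" for \<xi>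
      unfolding eq by (auto simp: plane_direction_def)
    then show False
      using soliton_no_orthogonal_max[OF c] le bd[OF p] by simp
  qed
qed

end

section \<open>The parallel case and the conclusion\<close>

text \<open>The direction \<open>w\<close> is tilted to \<open>w + e *\<^sub>R v\<close>, whose
  height attains its maximum on the boundary. There the \<open>w\<close>-part is \<open>b\<close>,
  and the \<open>v\<close>-part costs at most \<open>e * (2 * C)\<close>, which tends to 0 with
  \<open>e\<close>.\<close>

lemma soliton_parallel_le:
  assumes v: "norm v = 1" and soliton: "translating_soliton v M A \<psi>" and cpt: "compact_space M"
    and bd: "\<And>q. q \<in> surface_boundary A \<Longrightarrow> w \<bullet> \<psi> q = b"
    and wv: "w \<bullet> v = 0" and p: "p \<in> topspace M"
  shows "w \<bullet> \<psi> p \<le> b"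
proof -
  have "continuous_map M euclidean \<psi>"
    using soliton immersion_continuous_map by (auto simp: translating_soliton_def)
  then have "compact (\<psi> ` topspace M)"
    using image_compactin cpt by (fastforce simp: compact_space_def)
  then obtain C where C: "\<And>q. q \<in> topspace M \<Longrightarrow> norm (\<psi> q) \<le> C"
    by (meson bounded_iff compact_imp_bounded image_eqI)
  have bound: "\<bar>v \<bullet> \<psi> q\<bar> \<le> C" if "q \<in> topspace M" for q
    using Cauchy_Schwarz_ineq2[of v "\<psi> q"] C[OF that] v by simp
  have eps: "w \<bullet> \<psi> p \<le> b + e * (2 * C)" if e: "e > 0" for e
  proof -
    \<comment> \<open>The product equals \<open>e\<close>, since \<open>w\<close> is orthogonal to
      the unit vector \<open>v\<close>.\<close>
    have "(w + e *\<^sub>R v) \<bullet> v > 0"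
      using e wv v by (simp add: inner_add_left dot_square_norm)
    then obtain q where q: "q \<in> surface_boundary A"
      "(w + e *\<^sub>R v) \<bullet> \<psi> p \<le> (w + e *\<^sub>R v) \<bullet> \<psi> q"
      using soliton_max_on_boundary[OF soliton _ cpt] p by blast
    have "q \<in> topspace M"
      using soliton q(1) surface_boundary_subset by (auto simp: translating_soliton_def)
    then have "v \<bullet> \<psi> q - v \<bullet> \<psi> p \<le> 2 * C"
      using bound[of q] bound[OF p] by (simp add: abs_le_iff)
    then have "e * (v \<bullet> \<psi> q - v \<bullet> \<psi> p) \<le> e * (2 * C)"
      using e by (simp add: mult_left_mono)
    then show ?thesis
      using q(2) bd[OF q(1)] by (simp add: inner_add_left algebra_simps)
  qed
  have "((\<lambda>e. b + e * (2 * C)) \<longlongrightarrow> b + 0 * (2 * C)) (at_right 0)"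
    by (intro tendsto_intros)
  then have "w \<bullet> \<psi> p \<le> b + 0 * (2 * C)"
  proof (rule tendsto_lowerbound)
    show "\<forall>\<^sub>F e in at_right 0. w \<bullet> \<psi> p \<le> b + e * (2 * C)"
      using eps eventually_at_right_less by (rule eventually_mono[rotated])
  qed simp
  then show ?thesis by simp
qed

theorem theorem3p1:
  fixes M :: "'a topology" and A :: "'a chart set" and \<psi> :: "'a \<Rightarrow> real^3"
    and v a :: "real^3" and b :: real and \<Gamma> :: "(real^3) set"
  assumes "norm v = 1"
    and "translating_soliton v M A \<psi>"
    and "compact_space M"
    and "closed_curve \<Gamma>"
    and "has_boundary_curve M A \<psi> \<Gamma>"
    and "a \<noteq> 0"
    and "\<Gamma> \<subseteq> plane a b"
  shows "(v \<in> plane_direction a \<and> \<psi> ` topspace M \<subseteq> plane a b) \<or>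
         (v \<notin> plane_direction a \<and>
          (\<psi> ` surface_interior M A \<subseteq> {x. a \<bullet> x < b} \<or>
           \<psi> ` surface_interior M A \<subseteq> {x. a \<bullet> x > b}) \<and>
          (\<forall>p\<in>surface_boundary A. tangent_plane A \<psi> p \<noteq> plane_direction a))"
proof -
  have BM: "surface_boundary A \<subseteq> topspace M"
    using assms(2) surface_boundary_subset by (auto simp: translating_soliton_def)
  have "\<psi> ` surface_boundary A = \<Gamma>"
    using assms(5) BM homeomorphic_imp_surjective_map
    unfolding has_boundary_curve_def Let_def by (fastforce simp: Int_absorb1)
  then have bd: "a \<bullet> \<psi> q = b" if "q \<in> surface_boundary A" for q
    using assms(7) that by (auto simp: plane_def)
  then have bd': "(- a) \<bullet> \<psi> q = - b" if "q \<in> surface_boundary A" for q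
    using that by simp
  \<comment> \<open>The normals \<open>a\<close> and \<open>- a\<close>, with levels
    \<open>b\<close> and \<open>- b\<close>, describe the same plane. In the parallel case both are
    used and give the two inequalities; otherwise the one with positive product with
    \<open>v\<close> is used, and the interior lies on the side away from which \<open>v\<close>
    points.\<close>
  consider "a \<bullet> v = 0" | "0 < a \<bullet> v" | "0 < (- a) \<bullet> v"
    by fastforce
  then show ?thesis
  proof cases
    case 1
    have "a \<bullet> \<psi> p = b" if "p \<in> topspace M" for p
      using soliton_parallel_le[OF assms(1-3) bd 1 that]
        soliton_parallel_le[OF assms(1-3) bd' _ that] 1 by simp
    with 1 show ?thesis by (auto simp: plane_def plane_direction_def)
  next
    case 2
    then show ?thesis
      using soliton_one_side[OF assms(2) 2 assms(3) bd]
      by (auto simp: plane_direction_def)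
  next
    case 3
    have "plane_direction (- a) = plane_direction a"
      by (simp add: plane_direction_def)
    then show ?thesis
      using 3 soliton_one_side[OF assms(2) 3 assms(3) bd']
      by (auto simp: plane_direction_def)
  qed
qed

end
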